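(* Let $n\ge 3$ and $k\ge 0$ be integers. If $\mathbf{G}_n^k$ is the graph of critical pairs of the generalized crown $\mathbb{S}_n^k$, then $\mathbf{G}_n^k$ is isomorphic, as a graph, to $\mathcal{BC}_{n+k}^{k+1}$.
   Context: **Generalized crown.** For integers $n\ge 3$, $k\ge 0$, the generalized crown $\mathbb{S}_n^k$ is the height 2 poset with minimal elements $a_1,\dots,a_{n+k}$ and maximal elements $b_1,\dots,b_{n+k}$ (so distinct $a$'s are mutually incomparable, and distinct $b$'s are mutually incomparable), where, with all subscripts read cyclically modulo $n+k$: $b_i$ is incomparable to $a_i,a_{i+1},\dots,a_{i+k}$, and $b_i>a_{i+k+1},a_{i+k+2},\dots,a_{i-1}$ (these are $n-1$ elements). **Critical pairs.** Write $x\|y$ for "$x$ and $y$ are incomparable", and $\mathrm{Inc}(\mathbb{S}_n^k)=\{(x,y): x\|y\}$. An ordered pair $(x,y)$ is critical if $x\|y$, $D(x)\subseteq D(y)$ and $U(y)\subseteq U(x)$, where $D(u)=\{z: z<u\}$ and $U(w)=\{z: w<z\}$. Let $\mathrm{Crit}(\mathbb{S}_n^k)$ be the set of critical pairs. The dual of the pair $(x,y)$ is $(y,x)$. **Alternating cycles.** An alternating cycle is a sequence $\{(x_i,y_i):1\le i\le m\}$ of pairs in $\mathrm{Inc}(\mathbb{S}_n^k)$ with $y_i\le x_{i+1}$ (indices cyclic) for all $i$. It is strict if for all $i,j\in\{1,\dots,m\}$: $y_i\le x_j$ if and only if $j=i+1$ (cyclically). **Graph of critical pairs.** $\mathbf{G}_n^k$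 is the graph with vertex set $\mathrm{Crit}(\mathbb{S}_n^k)$ whose edges are the 2-element subsets of $\mathrm{Crit}(\mathbb{S}_n^k)$ whose duals form a strict alternating cycle. **Block circulant matrices.** Given $t\times t$ matrices $C_1,\dots,C_s$, the $t$-block circulant matrix $\mathrm{circ}(C_1,\dots,C_s)$ with generating block row $C_1,\dots,C_s$ is the $st\times st$ matrix whose first block row is $C_1,C_2,\dots,C_s$ and in which each subsequent block row is the cyclic shift by one block to the right of the previous one (second block row: $C_s,C_1,\dots,C_{s-1}$, etc.). **The graphs $\mathcal{BC}_s^t$.** Let $t\ge 1$, $s\ge t+2$. $\mathcal{BC}_s^t$ is the graph whose adjacency matrix is the $t$-block circulant matrix $\mathrm{circ}(B_1,\dots,B_s)$ with $t\times t$ blocks $B_i$ defined below. For $1\le i\le t$, let $\mathbb{1}^{i}$ be the $t\times t$ matrix with an $i\times i$ block of ones in the upper right corner and zeros elsewhere; let ${}_{i}\mathbb{1}$ be the $t\times t$ matrix with an $i\times i$ block of ones in the lower left corner and zeros elsewhere; $\mathbb{1}_{p\times p}$ and $\mathbb{0}_{p\times p}$ are the all-ones and zero $p\times p$ matrices. Case 1, $s\ge 2t$: $$B_i=\begin{cases}\mathbb{0}_{t\times t}& i=1\\ \mathbb{1}^{i-1}& 2\le i\le t\\ \mathbb{1}_{t\times t}& t+1\le i\le s-t+1\\ {}_{s+1-i}\mathbb{1}& s-t+2\le i\le s.\end{cases}$$ Case 2, $s\le 2t-1$: $$B_i=\begin{cases}\mathbb{0}_{t\times t}& i=1\\ \mathbb{1}^{i-1}&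 2\le i\le s-t+1\\ \begin{bmatrix}0&0&\mathbb{0}_{(t-s-1+i)\times(t-s-1+i)}\\0&\mathbb{1}_{(s-t)\times(s-t)}&0\\ \mathbb{0}_{(t-i+1)\times(t-i+1)}&0&0\end{bmatrix}& s-t+2\le i\le t\\ {}_{s-i+1}\mathbb{1}& t+1\le i\le s.\end{cases}$$ *)

theory Defs
  imports Main "Jordan_Normal_Form.Matrix"
begin

section \<open>Posets, critical pairs and alternating cycles\<close>

text \<open>
  A poset is given by its reflexive order relation \<open>r\<close>, so its ground set is \<open>Field r\<close> and
  \<open>x \<le> y\<close> reads \<open>(x, y) \<in> r\<close>. The sets \<open>D(u)\<close> and \<open>U(u)\<close> of elements strictly below and strictly
  above \<open>u\<close> are the library's \<^const>\<open>underS\<close> and \<^const>\<open>aboveS\<close>.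
\<close>

definition Inc :: "'a rel \<Rightarrow> 'a rel" where
  "Inc r = {(x, y). x \<in> Field r \<and> y \<in> Field r \<and> (x, y) \<notin> r \<and> (y, x) \<notin> r}"

definition Crit :: "'a rel \<Rightarrow> 'a rel" where
  "Crit r = {(x, y). (x, y) \<in> Inc r \<and> underS r x \<subseteq> underS r y \<and> aboveS r y \<subseteq> aboveS r x}"

definition alternating_cycle :: "'a rel \<Rightarrow> ('a \<times> 'a) list \<Rightarrow> bool" where
  "alternating_cycle r ps \<longleftrightarrow>
     ps \<noteq> [] \<and> set ps \<subseteq> Inc r \<and>
     (\<forall>i < length ps. (snd (ps ! i), fst (ps ! (Suc i mod length ps))) \<in> r)"

definition strict_alternating_cycle :: "'a rel \<Rightarrow> ('a \<times> 'a) list \<Rightarrow> bool" where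
  "strict_alternating_cycle r ps \<longleftrightarrow>
     alternating_cycle r ps \<and>
     (\<forall>i < length ps. \<forall>j < length ps.
        (snd (ps ! i), fst (ps ! j)) \<in> r \<longleftrightarrow> j = Suc i mod length ps)"

text \<open>Strictness forces the entries of the cycle to be distinct.\<close>

lemma strict_alternating_cycle_distinct:
  assumes "strict_alternating_cycle r ps"
  shows "distinct ps"
proof (unfold distinct_conv_nth, intro allI impI notI)
  fix i j assume ij: "i < length ps" "j < length ps" "i \<noteq> j" "ps ! i = ps ! j"
  let ?i' = "Suc i mod length ps"
  have i': "?i' < length ps" using ij by (intro mod_less_divisor) auto
  then have "(snd (ps ! i), fst (ps ! ?i')) \<in> r"
    using assms ij(1) i' unfolding strict_alternating_cycle_def by blast
  then have "(snd (ps ! j), fst (ps ! ?i')) \<in> r" using ij by simp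
  then have "?i' = Suc j mod length ps"
    using assms ij(2) i' unfolding strict_alternating_cycle_def by blast
  then show False using ij by (auto simp: mod_Suc split: if_splits)
qed


section \<open>Simple graphs\<close>

record 'v graph =
  verts :: "'v set"
  edges :: "'v set set"

definition graph_iso :: "'v graph \<Rightarrow> 'w graph \<Rightarrow> bool" where
  "graph_iso G H \<longleftrightarrow>
     (\<exists>f. bij_betw f (verts G) (verts H) \<and>
        (\<forall>u \<in> verts G. \<forall>v \<in> verts G. {u, v} \<in> edges G \<longleftrightarrow> {f u, f v} \<in> edges H))"

text \<open>The set of duals of the pairs in \<open>e\<close> is the converse relation \<open>e\<inverse>\<close>.\<close>

definition crit_graph :: "'a rel \<Rightarrow> ('a \<times> 'a) graph" where
  "crit_graph r =
     \<lparr> verts = Crit r,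
       edges = {e. e \<subseteq> Crit r \<and> card e = 2 \<and>
                   (\<exists>ps. strict_alternating_cycle r ps \<and> set ps = e\<inverse>)} \<rparr>"

definition graph_of_adj :: "nat mat \<Rightarrow> nat graph" where
  "graph_of_adj A =
     \<lparr> verts = {..<dim_row A},
       edges = {{u, v} | u v. u < dim_row A \<and> v < dim_row A \<and> A $$ (u, v) = 1} \<rparr>"


section \<open>Generalized crowns\<close>

text \<open>
  The subscripts are the residues \<open>0, \<dots>, n + k - 1\<close> modulo \<open>n + k\<close>; in particular \<open>0\<close> plays the
  role of the subscript \<open>n + k\<close>.
\<close>

datatype crown_elem = A nat | B nat

definition crown_carrier :: "nat \<Rightarrow> nat \<Rightarrow> crown_elem set" where
  "crown_carrier n k = A ` {..<n + k} \<union> B ` {..<n + k}"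

definition crown :: "nat \<Rightarrow> nat \<Rightarrow> crown_elem rel" where
  "crown n k =
     Id_on (crown_carrier n k) \<union>
     {(A ((i + d) mod (n + k)), B i) | i d. i < n + k \<and> d \<in> {k + 1..n + k - 1}}"

lemma crown_subset: "crown n k \<subseteq> crown_carrier n k \<times> crown_carrier n k"
proof -
  have "(i + d) mod (n + k) < n + k" if "i < n + k" for i d
    using that by (intro mod_less_divisor) auto
  then show ?thesis by (fastforce simp: crown_def crown_carrier_def)
qed

lemma Field_crown: "Field (crown n k) = crown_carrier n k"
proof
  show "Field (crown n k) \<subseteq> crown_carrier n k"
    using crown_subset by (auto simp: Field_def)
  show "crown_carrier n k \<subseteq> Field (crown n k)"
    by (auto simp: crown_def intro: FieldI1)
qed

lemma partial_order_crown: "partial_order_on (crown_carrier n k) (crown n k)"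
proof -
  have "refl_on (crown_carrier n k) (crown n k)"
    using crown_subset by (auto simp: refl_on_def crown_def)
  moreover have "trans (crown n k)" "antisym (crown n k)"
    by (auto simp: trans_def antisym_def crown_def)
  ultimately show ?thesis
    using crown_subset by (auto simp: partial_order_on_def preorder_on_def)
qed


section \<open>The block circulant graphs\<close>

definition block_circ :: "nat \<Rightarrow> 'a mat list \<Rightarrow> 'a mat" where
  "block_circ t Cs =
     (let s = length Cs in
      mat (s * t) (s * t)
        (\<lambda>(x, y). (Cs ! ((y div t + s - x div t) mod s)) $$ (x mod t, y mod t)))"

text \<open>
  \<open>ones_block t r0 c0 p\<close> is the \<open>t \<times> t\<close> matrix with a \<open>p \<times> p\<close> block of ones that has \<open>r0\<close> zero rows
  above it and \<open>c0\<close> zero columns to its left, and zeros elsewhere.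
\<close>

definition ones_block :: "nat \<Rightarrow> nat \<Rightarrow> nat \<Rightarrow> nat \<Rightarrow> nat mat" where
  "ones_block t r0 c0 p =
     mat t t (\<lambda>(r, c). if r0 \<le> r \<and> r < r0 + p \<and> c0 \<le> c \<and> c < c0 + p then 1 else 0)"

definition upper_right_ones :: "nat \<Rightarrow> nat \<Rightarrow> nat mat" where
  "upper_right_ones t i = ones_block t 0 (t - i) i"

definition lower_left_ones :: "nat \<Rightarrow> nat \<Rightarrow> nat mat" where
  "lower_left_ones t i = ones_block t (t - i) 0 i"

text \<open>
  The \<open>i\<close>-th block, for \<open>1 \<le> i \<le> s\<close>. In the middle block of the second case, the zero block in the
  upper right corner has size \<open>t - s - 1 + i\<close> and the one in the lower left corner has size
  \<open>t - i + 1\<close>; these are the numbers of rows above, respectively columns to the left of, the ones.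
\<close>

definition BC_block :: "nat \<Rightarrow> nat \<Rightarrow> nat \<Rightarrow> nat mat" where
  "BC_block s t i =
     (if 2 * t \<le> s then
        (if i = 1 then 0\<^sub>m t t
         else if i \<le> t then upper_right_ones t (i - 1)
         else if i \<le> s - t + 1 then ones_block t 0 0 t
         else lower_left_ones t (s + 1 - i))
      else
        (if i = 1 then 0\<^sub>m t t
         else if i \<le> s - t + 1 then upper_right_ones t (i - 1)
         else if i \<le> t then ones_block t (t + i - s - 1) (t - i + 1) (s - t)
         else lower_left_ones t (s - i + 1)))"

definition BC_mat :: "nat \<Rightarrow> nat \<Rightarrow> nat mat" where
  "BC_mat s t = block_circ t (map (BC_block s t) [1..<s + 1])"

definition BC :: "nat \<Rightarrow> nat \<Rightarrow> nat graph" where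
  "BC s t = graph_of_adj (BC_mat s t)"

text \<open>The matrix is indeed the adjacency matrix of a simple graph.\<close>

lemma BC_block_index:
  assumes "t + 2 \<le> s" "1 \<le> d" "d < s" "r < t" "c < t"
  shows "BC_block s t (d + 1) $$ (r, c) =
    (if t \<le> c + d \<and> r < d \<and> t + d \<le> r + s \<and> c + d < s then 1 else 0)"
proof -
  consider "2 * t \<le> s" "d < t" | "2 * t \<le> s" "t \<le> d" "d \<le> s - t" | "2 * t \<le> s" "s - t < d"
    | "s < 2 * t" "d \<le> s - t" | "s < 2 * t" "s - t < d" "d < t" | "s < 2 * t" "t \<le> d"
    by linarith
  then show ?thesis
    using assms
    by cases
      (simp_all add: BC_block_def upper_right_ones_def lower_left_ones_def ones_block_def,
        linarith+)
qed

lemma BC_block_sym: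
  assumes "t + 2 \<le> s" "1 \<le> d" "d < s" "r < t" "c < t"
  shows "BC_block s t (d + 1) $$ (r, c) = BC_block s t (s - d + 1) $$ (c, r)"
  using assms BC_block_index[of t s d r c] BC_block_index[of t s "s - d" c r] by auto

lemma dim_BC_mat [simp]: "dim_row (BC_mat s t) = s * t" "dim_col (BC_mat s t) = s * t"
  by (simp_all add: BC_mat_def block_circ_def Let_def)

lemma BC_mat_index:
  assumes "x < s * t" "y < s * t"
  shows "BC_mat s t $$ (x, y) =
    BC_block s t ((y div t + s - x div t) mod s + 1) $$ (x mod t, y mod t)"
proof -
  have "s > 0" using assms by (cases s) auto
  then show ?thesis using assms by (simp add: BC_mat_def block_circ_def Let_def del: upt_Suc)
qed

lemma BC_mat_diag:
  assumes "x < s * t"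
  shows "BC_mat s t $$ (x, x) = 0"
proof -
  have "t > 0" using assms by (cases t) auto
  then show ?thesis using assms by (simp add: BC_mat_index BC_block_def)
qed

lemma BC_mat_sym:
  assumes "t + 2 \<le> s" "x < s * t" "y < s * t"
  shows "BC_mat s t $$ (x, y) = BC_mat s t $$ (y, x)"
proof -
  have t: "t > 0" using assms by (cases t) auto
  let ?p = "x div t" and ?q = "y div t"
  have pq: "?p < s" "?q < s" using assms t by (simp_all add: less_mult_imp_div_less)
  define d where "d = (?q + s - ?p) mod s"
  have "d = (if ?p \<le> ?q then ?q - ?p else ?q + s - ?p)"
    using pq by (auto simp: d_def mod_if)
  moreover have "(?p + s - ?q) mod s = (if ?q \<le> ?p then ?p - ?q else ?p + s - ?q)"
    using pq by (auto simp: mod_if)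
  ultimately have d': "(?p + s - ?q) mod s = (if d = 0 then 0 else s - d)" and "d < s"
    using pq by auto
  show ?thesis
  proof (cases "d = 0")
    case True
    then show ?thesis
      using assms t d' by (simp add: BC_mat_index d_def[symmetric] BC_block_def)
  next
    case False
    then show ?thesis
      using assms t d' \<open>d < s\<close> BC_block_sym[of t s d "x mod t" "y mod t"]
      by (simp add: BC_mat_index d_def[symmetric])
  qed
qed

end

theory Submission
  imports Defs
begin

text \<open>
  The critical pairs of the crown are exactly the incomparable pairs \<open>(a\<^bsub>i+d\<^esub>, b\<^bsub>i\<^esub>)\<close> with
  \<open>0 \<le> d \<le> k\<close>, and two critical pairs \<open>(a, b)\<close>, \<open>(a', b')\<close> are adjacent iff \<open>a < b'\<close> and \<open>a' < b\<close>.
  For the pairs \<open>(a\<^bsub>i+d\<^esub>, b\<^bsub>i\<^esub>)\<close> and \<open>(a\<^bsub>j+e\<^esub>, b\<^bsub>j\<^esub>)\<close> this depends only on \<open>d\<close>, \<open>e\<close> and the residue of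
  \<open>j - i\<close>, and the condition is the one for entry \<open>(d, e)\<close> of the corresponding block to be \<open>1\<close>. So
  numbering the pair \<open>(a\<^bsub>i+d\<^esub>, b\<^bsub>i\<^esub>)\<close> by \<open>i (k + 1) + d\<close> gives the isomorphism.
\<close>

section \<open>Graph isomorphisms and adjacency of critical pairs\<close>

lemma graph_isoI_inverse:
  assumes "bij_betw g (verts H) (verts G)"
    and "\<And>u v. u \<in> verts H \<Longrightarrow> v \<in> verts H \<Longrightarrow> {g u, g v} \<in> edges G \<longleftrightarrow> {u, v} \<in> edges H"
  shows "graph_iso G H"
  unfolding graph_iso_def
proof (intro exI conjI ballI)
  let ?f = "inv_into (verts H) g"
  show bij: "bij_betw ?f (verts G) (verts H)"
    using assms(1) by (rule bij_betw_inv_into)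
  fix u v assume "u \<in> verts G" "v \<in> verts G"
  moreover from this have "?f u \<in> verts H" "?f v \<in> verts H"
    using bij by (auto simp: bij_betw_def)
  ultimately show "{u, v} \<in> edges G \<longleftrightarrow> {?f u, ?f v} \<in> edges H"
    using assms(2)[of "?f u" "?f v"] bij_betw_inv_into_right[OF assms(1)] by simp
qed

text \<open>Strict alternating cycles have distinct entries, so one formed by the duals of two
  critical pairs has length 2. Strictness then asks for these two comparabilities and for two
  failures, which are the incomparabilities inside \<open>u\<close> and \<open>v\<close>.\<close>

lemma edges_crit_graph_iff:
  assumes u: "u \<in> Crit r" and v: "v \<in> Crit r"
  shows "{u, v} \<in> edges (crit_graph r) \<longleftrightarrow> (fst u, snd v) \<in> r \<and> (fst v, snd u) \<in> r"
proof
  assume "{u, v} \<in> edges (crit_graph r)"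
  then obtain ps where card: "card {u, v} = 2"
    and cyc: "strict_alternating_cycle r ps" and set: "set ps = {u, v}\<inverse>"
    by (auto simp: crit_graph_def)
  have ne: "u \<noteq> v"
    using card by auto
  have conv: "{u, v}\<inverse> = {prod.swap u, prod.swap v}"
    by (auto simp: prod_eq_iff)
  have "prod.swap u \<noteq> prod.swap v"
    using ne by (auto simp: prod_eq_iff)
  then have "length ps = 2"
    using distinct_card[OF strict_alternating_cycle_distinct[OF cyc]] set conv by simp
  then obtain p q where ps: "ps = [p, q]"
    by (auto simp: numeral_2_eq_2 length_Suc_conv)
  have "(snd p, fst q) \<in> r" "(snd q, fst p) \<in> r"
    using cyc by (auto simp: strict_alternating_cycle_def alternating_cycle_def ps less_Suc_eq)
  moreover have "{p, q} = {prod.swap u, prod.swap v}"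
    using set conv ps by simp
  ultimately show "(fst u, snd v) \<in> r \<and> (fst v, snd u) \<in> r"
    by (auto simp: doubleton_eq_iff)
next
  assume r: "(fst u, snd v) \<in> r \<and> (fst v, snd u) \<in> r"
  have inc: "(fst u, snd u) \<notin> r" "(fst v, snd v) \<notin> r" "prod.swap u \<in> Inc r" "prod.swap v \<in> Inc r"
    using u v by (auto simp: Crit_def Inc_def)
  have "strict_alternating_cycle r [prod.swap u, prod.swap v]"
    using r inc by (auto simp: strict_alternating_cycle_def alternating_cycle_def less_Suc_eq)
  moreover have "set [prod.swap u, prod.swap v] = {u, v}\<inverse>"
    by (auto simp: prod_eq_iff)
  moreover have "u \<noteq> v"
    using r inc(1) by blast
  then have "card {u, v} = 2"
    by simp
  ultimately show "{u, v} \<in> edges (crit_graph r)"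
    using u v unfolding crit_graph_def by auto
qed

section \<open>Cyclic offsets and the critical pairs of the crown\<close>

lemma mod_nat_diff_eq:
  fixes x j s :: nat
  assumes "x < s" "j < s"
  shows "(x + s - j) mod s = (if j \<le> x then x - j else x + s - j)"
  using assms by (auto simp: mod_if)

lemma mod_nat_add_eq:
  fixes i d s :: nat
  assumes "i < s" "d < s"
  shows "(i + d) mod s = (if i + d < s then i + d else i + d - s)"
  using assms by (auto simp: mod_if)

text \<open>The offset \<open>d\<close> in the definition of \<open>crown\<close> is recovered as
  the residue of \<open>x - j\<close>; adding \<open>n + k\<close> first avoids truncated
  subtraction.\<close>

lemma crown_AB_iff:
  assumes "x < n + k" "j < n + k"
  shows "(A x, B j) \<in> crown n k \<longleftrightarrow> k < (x + (n + k) - j) mod (n + k)"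
proof
  assume "(A x, B j) \<in> crown n k"
  then obtain d where "x = (j + d) mod (n + k)" "k < d" "d < n + k"
    by (auto simp: crown_def)
  then show "k < (x + (n + k) - j) mod (n + k)"
    using assms by (auto simp: mod_nat_diff_eq mod_nat_add_eq split: if_splits)
next
  let ?d = "(x + (n + k) - j) mod (n + k)"
  assume k: "k < ?d"
  have d: "?d < n + k"
    using assms by (intro mod_less_divisor) linarith
  have "x = (j + ?d) mod (n + k)"
    unfolding mod_nat_add_eq[OF assms(2) d] using assms by (auto simp: mod_nat_diff_eq)
  moreover have "?d \<in> {k + 1..n + k - 1}"
    using k d by (simp only: atLeastAtMost_iff) linarith
  ultimately show "(A x, B j) \<in> crown n k"
    using assms(2) unfolding crown_def by blast
qed

lemma crown_simps:
  "(A x, A y) \<in> crown n k \<longleftrightarrow> x = y \<and> x < n + k"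
  "(B x, B y) \<in> crown n k \<longleftrightarrow> x = y \<and> x < n + k"
  "(B x, A y) \<notin> crown n k"
  by (auto simp: crown_def crown_carrier_def)

text \<open>
  Witness: \<open>b\<^bsub>p\<^esub>\<close> if it lies above \<open>a\<^bsub>q\<^esub>\<close>. Otherwise \<open>q - p\<close> has residue at most \<open>k\<close>, and the
  cyclically last element \<open>b\<^bsub>q-k-1\<^esub>\<close> of the up-set of \<open>a\<^bsub>q\<^esub>\<close> works.
\<close>

lemma crown_aboveS_A_not_subset:
  assumes "n \<ge> 2" "p < n + k" "q < n + k" "p \<noteq> q"
  shows "\<not> aboveS (crown n k) (A q) \<subseteq> aboveS (crown n k) (A p)"
proof -
  have "\<exists>j < n + k. (A q, B j) \<in> crown n k \<and> (A p, B j) \<notin> crown n k"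
  proof (cases "(A q, B p) \<in> crown n k")
    case True
    then show ?thesis
      using assms by (intro exI[of _ p]) (auto simp: crown_AB_iff)
  next
    case False
    let ?j = "if k + 1 \<le> q then q - (k + 1) else q + n - 1"
    have "?j < n + k"
      using assms by auto
    moreover from this False have "(A q, B ?j) \<in> crown n k \<and> (A p, B ?j) \<notin> crown n k"
      using assms by (auto simp: crown_AB_iff mod_nat_diff_eq split: if_splits)
    ultimately show ?thesis
      by blast
  qed
  then show ?thesis
    by (auto simp: aboveS_def)
qed

lemma crown_underS_B_not_subset:
  assumes "n \<ge> 2" "p < n + k" "q < n + k" "p \<noteq> q"
  shows "\<not> underS (crown n k) (B p) \<subseteq> underS (crown n k) (B q)"
proof -
  have "\<exists>x < n + k. (A x, B p) \<in> crown n k \<and> (A x, B q) \<notin> crown n k"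
  proof (cases "(A q, B p) \<in> crown n k")
    case True
    then show ?thesis
      using assms by (intro exI[of _ q]) (auto simp: crown_AB_iff)
  next
    case False
    \<comment> \<open>This is \<open>p + k + 1\<close> modulo \<open>n + k\<close>, the cyclically
      first index below \<open>B p\<close>. Here \<open>q - p\<close> has a residue \<open>r\<close>
      with \<open>1 \<le> r \<le> k\<close>, so the offset of \<open>?x\<close> from
      \<open>q\<close> is \<open>k + 1 - r\<close>, at most \<open>k\<close>.\<close>
    let ?x = "if p + k + 1 < n + k then p + k + 1 else p + 1 - n"
    have "?x < n + k"
      using assms by auto
    moreover from this False have "(A ?x, B p) \<in> crown n k \<and> (A ?x, B q) \<notin> crown n k"
      using assms by (auto simp: crown_AB_iff mod_nat_diff_eq split: if_splits)
    ultimately show ?thesis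
      by blast
  qed
  then show ?thesis
    by (auto simp: underS_def)
qed

text \<open>Rules out critical pairs of the form \<open>(B p, A q)\<close>, since nothing lies
  strictly below \<open>A q\<close>.\<close>

lemma crown_underS_B_nonempty:
  assumes "n \<ge> 2" "p < n + k"
  shows "underS (crown n k) (B p) \<noteq> {}"
proof -
  let ?q = "if p = 0 then 1 else 0 :: nat"
  have "\<not> underS (crown n k) (B p) \<subseteq> underS (crown n k) (B ?q)"
    using assms by (intro crown_underS_B_not_subset) auto
  then show ?thesis by auto
qed

lemma underS_crown_A: "underS (crown n k) (A p) = {}"
proof -
  have "(z, A p) \<in> crown n k \<Longrightarrow> z = A p" for z
    by (cases z) (auto simp: crown_simps)
  then show ?thesis by (auto simp: underS_def)
qed

lemma aboveS_crown_B: "aboveS (crown n k) (B p) = {}"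
proof -
  have "(B p, z) \<in> crown n k \<Longrightarrow> z = B p" for z
    by (cases z) (auto simp: crown_simps)
  then show ?thesis by (auto simp: aboveS_def)
qed

text \<open>For \<open>(A x, B i)\<close> both inclusions are trivial, as \<open>underS\<close> of
  the first and \<open>aboveS\<close> of the second are empty. Two distinct \<open>A\<close>s fail
  on up-sets, two distinct \<open>B\<close>s on down-sets.\<close>

lemma Crit_crown:
  assumes "n \<ge> 2"
  shows "Crit (crown n k) =
    {(A x, B i) | x i. x < n + k \<and> i < n + k \<and> (A x, B i) \<notin> crown n k}"
    (is "_ = ?C")
proof
  show "?C \<subseteq> Crit (crown n k)"
    by (auto simp: Crit_def Inc_def Field_crown crown_carrier_def crown_simps
        underS_crown_A aboveS_crown_B)
  show "Crit (crown n k) \<subseteq> ?C"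
  proof
    fix z assume "z \<in> Crit (crown n k)"
    moreover obtain x y where "z = (x, y)"
      by (cases z)
    ultimately show "z \<in> ?C"
      using assms crown_aboveS_A_not_subset[of n] crown_underS_B_not_subset[of n]
        crown_underS_B_nonempty[of n]
      by (cases x; cases y)
        (auto simp: Crit_def Inc_def Field_crown crown_carrier_def crown_simps underS_crown_A)
  qed
qed

section \<open>Numbering the critical pairs and matching the matrix entries\<close>

definition crit_pair :: "nat \<Rightarrow> nat \<Rightarrow> nat \<Rightarrow> crown_elem \<times> crown_elem" where
  "crit_pair n k v =
     (A ((v div (k + 1) + v mod (k + 1)) mod (n + k)), B (v div (k + 1)))"

lemma bij_betw_crit_pair:
  assumes "n \<ge> 2"
  shows "bij_betw (crit_pair n k) {..<(n + k) * (k + 1)} (Crit (crown n k))"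
proof (rule bij_betw_byWitness)
  let ?s = "n + k" and ?t = "k + 1"
  \<comment> \<open>The inverse numbering. Offsets \<open>d \<le> k\<close> stay below
    \<open>n + k\<close>, so the residue of \<open>x - i\<close> returns \<open>d\<close>. The
    default \<open>0\<close> is never reached on critical pairs.\<close>
  define f where "f = (\<lambda>(a, b). case (a, b) of
    (A x, B i) \<Rightarrow> i * ?t + (x + ?s - i) mod ?s | _ \<Rightarrow> 0)"
  have bounds: "v div ?t < ?s" "v mod ?t < ?t" "v mod ?t < ?s" if "v < ?s * ?t" for v
  proof -
    show "v div ?t < ?s"
      using that by (simp add: less_mult_imp_div_less)
    show "v mod ?t < ?t"
      by simp
    then show "v mod ?t < ?s"
      using assms by linarith
  qed
  have offset: "((i + d) mod ?s + ?s - i) mod ?s = d" if "i < ?s" "d < ?s" for i d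
    using that assms by (auto simp: mod_nat_add_eq mod_nat_diff_eq)
  show "\<forall>v \<in> {..<?s * ?t}. f (crit_pair n k v) = v"
    using bounds offset by (simp add: f_def crit_pair_def del: mult_Suc_right)
  show "crit_pair n k ` {..<?s * ?t} \<subseteq> Crit (crown n k)"
  proof
    fix z assume "z \<in> crit_pair n k ` {..<?s * ?t}"
    then obtain v where "v < ?s * ?t" and z: "z = crit_pair n k v"
      by blast
    then have b: "v div ?t < ?s" "v mod ?t < ?t" "v mod ?t < ?s"
      using bounds by blast+
    then show "z \<in> Crit (crown n k)"
      using assms offset[OF b(1,3)] mod_less_divisor[of "Suc k" v]
      by (simp add: Crit_crown crit_pair_def z crown_AB_iff not_less less_Suc_eq_le)
  qed
  have crit: "i * ?t + d < ?s * ?t \<and> crit_pair n k (i * ?t + d) = (A ((i + d) mod ?s), B i)"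
    if "i < ?s" "d \<le> k" for i d
  proof
    have "i * ?t + d < (i + 1) * ?t"
      using that by simp
    also have "\<dots> \<le> ?s * ?t"
      using that by (intro mult_le_mono1) simp
    finally show "i * ?t + d < ?s * ?t" .
    have "(i * ?t + d) div ?t = i" "(i * ?t + d) mod ?t = d"
      using that by (simp_all only: div_mult_self3 mod_mult_self3) simp_all
    then show "crit_pair n k (i * ?t + d) = (A ((i + d) mod ?s), B i)"
      by (simp only: crit_pair_def)
  qed
  have *: "f z < ?s * ?t \<and> crit_pair n k (f z) = z" if "z \<in> Crit (crown n k)" for z
  proof -
    obtain x i where z: "z = (A x, B i)" "x < ?s" "i < ?s" "(x + ?s - i) mod ?s \<le> k"
      using \<open>z \<in> Crit (crown n k)\<close> assms by (auto simp: Crit_crown crown_AB_iff)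
    moreover have "(i + (x + ?s - i) mod ?s) mod ?s = x"
      using z by (auto simp: mod_nat_diff_eq)
    ultimately show ?thesis
      using crit[OF z(3,4)] by (simp add: f_def)
  qed
  then show "f ` Crit (crown n k) \<subseteq> {..<?s * ?t}" "\<forall>z \<in> Crit (crown n k). crit_pair n k (f z) = z"
    by auto
qed

lemma BC_mat_crit_pair_iff:
  assumes "n \<ge> 3" "u < (n + k) * (k + 1)" "v < (n + k) * (k + 1)"
  shows "BC_mat (n + k) (k + 1) $$ (u, v) = 1 \<longleftrightarrow>
    (fst (crit_pair n k u), snd (crit_pair n k v)) \<in> crown n k \<and>
    (fst (crit_pair n k v), snd (crit_pair n k u)) \<in> crown n k"
proof -
  let ?s = "n + k" and ?t = "k + 1"
  define i d j e where ijde: "i = u div ?t" "d = u mod ?t" "j = v div ?t" "e = v mod ?t"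
  have b: "i < ?s" "j < ?s"
    using assms by (simp_all add: ijde less_mult_imp_div_less)
  have de: "d < ?t" "e < ?t"
    by (simp_all add: ijde)
  then have des: "d < ?s" "e < ?s"
    using assms(1) by linarith+
  define \<delta> where "\<delta> = (j + ?s - i) mod ?s"
  have \<delta>: "\<delta> = (if i \<le> j then j - i else j + ?s - i)"
    using b mod_nat_diff_eq by (simp add: \<delta>_def)
  have "\<delta> < ?s"
    using b by (auto simp: \<delta>)
  have m1: "BC_mat ?s ?t $$ (u, v) = BC_block ?s ?t (\<delta> + 1) $$ (d, e)"
    using assms by (simp only: BC_mat_index ijde \<delta>_def)
  \<comment> \<open>\<open>BC_block_index\<close> excludes the diagonal block; that block is zero,
    in agreement with \<open>1 \<le> \<delta>\<close>.\<close>
  have m2: "BC_block ?s ?t (\<delta> + 1) $$ (d, e) = 1 \<longleftrightarrow>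
      1 \<le> \<delta> \<and> ?t \<le> e + \<delta> \<and> d < \<delta> \<and> ?t + \<delta> \<le> d + ?s \<and> e + \<delta> < ?s"
  proof (cases "\<delta> = 0")
    case True
    then show ?thesis
      using de by (simp add: BC_block_def)
  next
    case False
    then show ?thesis
      using BC_block_index[of ?t ?s \<delta> d e] de \<open>\<delta> < ?s\<close> assms(1) by simp
  qed
  have less: "(i + d) mod ?s < ?s" "(j + e) mod ?s < ?s"
    using assms(1) by (auto intro!: mod_less_divisor)
  \<comment> \<open>The residue of \<open>i + d - j\<close> is \<open>d - \<delta>\<close> if
    \<open>\<delta> \<le> d\<close>, hence at most \<open>k\<close>, and
    \<open>d + ?s - \<delta>\<close> otherwise.\<close>
  have c1: "(A ((i + d) mod ?s), B j) \<in> crown n k \<longleftrightarrow> d < \<delta> \<and> ?t + \<delta> \<le> d + ?s"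
    unfolding crown_AB_iff[OF less(1) b(2)] mod_nat_diff_eq[OF less(1) b(2)]
    unfolding mod_nat_add_eq[OF b(1) des(1)] \<delta>
    using b de des by (simp split: if_split) linarith
  \<comment> \<open>The residue of \<open>j + e - i\<close> is \<open>e + \<delta>\<close>, unless
    this reaches \<open>?s\<close>; then it is \<open>e + \<delta> - ?s < e \<le> k\<close>.\<close>
  have c2: "(A ((j + e) mod ?s), B i) \<in> crown n k \<longleftrightarrow> ?t \<le> e + \<delta> \<and> e + \<delta> < ?s"
    unfolding crown_AB_iff[OF less(2) b(1)] mod_nat_diff_eq[OF less(2) b(1)]
    unfolding mod_nat_add_eq[OF b(2) des(2)] \<delta>
    using b de des by (simp split: if_split) linarith
  show ?thesis
    unfolding m1 m2 crit_pair_def fst_conv snd_conv ijde[symmetric] c1 c2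
    by auto
qed

theorem theorem1p1:
  fixes n k :: nat
  assumes "n \<ge> 3"
  shows "graph_iso (crit_graph (crown n k)) (BC (n + k) (k + 1))"
proof (rule graph_isoI_inverse)
  \<comment> \<open>\<open>?g\<close> runs from matrix indices to critical pairs, against the
    direction of \<open>graph_iso\<close>; its inverse is the isomorphism.\<close>
  let ?g = "crit_pair n k" and ?N = "(n + k) * (k + 1)"
  have verts: "verts (BC (n + k) (k + 1)) = {..<?N}"
    by (simp add: BC_def graph_of_adj_def)
  have bij: "bij_betw ?g {..<?N} (Crit (crown n k))"
    using assms by (intro bij_betw_crit_pair) simp
  then show "bij_betw ?g (verts (BC (n + k) (k + 1))) (verts (crit_graph (crown n k)))"
    by (simp only: verts) (simp add: crit_graph_def)
  fix u v assume "u \<in> verts (BC (n + k) (k + 1))" "v \<in> verts (BC (n + k) (k + 1))"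
  then have uv: "u < ?N" "v < ?N"
    unfolding verts by simp_all
  then have crit: "?g u \<in> Crit (crown n k)" "?g v \<in> Crit (crown n k)"
    using bij by (auto simp: bij_betw_def)
  have "{u, v} \<in> edges (BC (n + k) (k + 1)) \<longleftrightarrow> BC_mat (n + k) (k + 1) $$ (u, v) = 1"
  proof -
    \<comment> \<open>An unordered edge may arise from either order of its endpoints, so symmetry is
      required.\<close>
    have "BC_mat (n + k) (k + 1) $$ (v, u) = BC_mat (n + k) (k + 1) $$ (u, v)"
      using BC_mat_sym[of "k + 1" "n + k" v u] uv assms by simp
    then show ?thesis
      using uv unfolding BC_def graph_of_adj_def
      by (auto simp: doubleton_eq_iff simp del: mult_Suc_right)
  qed
  then show "{?g u, ?g v} \<in> edges (crit_graph (crown n k)) \<longleftrightarrow>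
      {u, v} \<in> edges (BC (n + k) (k + 1))"
    using edges_crit_graph_iff[OF crit] BC_mat_crit_pair_iff[OF assms uv] by simp
qed

end
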